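(* Let $p$ be an even positive integer. For $\sigma>0$ and $\varepsilon>0$ let $$p(x)=\frac{C(\varepsilon)}{\sqrt{2\pi}\,\sigma}\,e^{-\frac{x^2}{2\sigma^2}}\,e^{-\varepsilon x^{p}},\qquad x\in\mathbb{R},$$ with $C(\varepsilon)>0$ the normalizing constant, and let $H=-\int_{-\infty}^{\infty}p(x)\log p(x)\,dx$ be its differential entropy. There is $\delta>0$, depending only on $p$, such that whenever $\varepsilon\sigma^p<\delta$ the following hold. (i) The first-order approximation $H_p^{(1)}$ of $H$ (defined in the context) equals $$H_p^{(1)}=\log\!\Big(\sqrt{2\pi}\,\sigma\big(1-\varepsilon\sigma^p(p-1)!!\big)\Big)+\frac{1}{1-\varepsilon\sigma^p(p-1)!!}\left[\frac12+\varepsilon\sigma^p\Big((p-1)!!-\tfrac12(p+1)!!\Big)\right].$$ (ii) The error $\Delta H_p(1)=H_p^{(1)}-H$ of this approximation satisfies $$\left|\Delta H_p(1)\right|\le\log\!\left(1+\beta_p\frac{\varepsilon^2}{2}(2p-1)!!\,\sigma^{2p}\right)+\beta_p\frac{\varepsilon^2}{4}(2p+1)!!\,\sigma^{2p}+\beta_p\frac{\varepsilon^3}{2}(3p-1)!!\,\sigma^{3p},$$ where $$\beta_p=\left(1-\varepsilon(p-1)!!\,\sigma^p-\frac{\varepsilon^2}{2}(2p-1)!!\,\sigma^{2p}\right)^{-1}.$$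
   Context: The double factorial is $m!!=m(m-2)(m-4)\cdots1$ for odd positive $m$, with $(-1)!!=1$. Write $\mu^G_{(k)}=\int_{-\infty}^\infty\frac{1}{\sqrt{2\pi}\sigma}e^{-x^2/(2\sigma^2)}x^k\,dx$ for the Gaussian moments, so $\mu^G_{(k)}=\sigma^k(k-1)!!$ for even $k$. With $\mu_{(k)}=\int x^kp(x)\,dx$, the entropy of the density is $$H=\frac12\log\frac{2\pi\sigma^2}{C(\varepsilon)^2}+\frac{\mu_{(2)}}{2\sigma^2}+\varepsilon\mu_{(p)}.$$ The first-order approximations of the normalization and the moments are obtained by expanding $e^{-\varepsilon x^p}$ to first order in $\varepsilon$: $$C_1=\frac{1}{1-\varepsilon\mu^G_{(p)}},\qquad \mu_{(k)}^{(1)}=C_1\left(\mu^G_{(k)}-\varepsilon\mu^G_{(p+k)}\right).$$ The first-order approximation $H_p^{(1)}$ of the entropy is obtained by substituting $C_1$ for $C(\varepsilon)$ and $\mu^{(1)}_{(k)}$ for $\mu_{(k)}$ in the formula for $H$, writing the result as $\log(\sqrt{2\pi}\sigma/C_1)+C_1\cdot B$ with $B$ a polynomial in $\varepsilon$ (keeping $C_1$ as an unexpanded factor), and discarding from $B$ the terms quadratic in $\varepsilon$. *)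

theory Defs
  imports "HOL-Probability.Probability" "HOL-Computational_Algebra.Polynomial"
begin

(* Only odd arguments are relevant. As 0 - 1 = 0 on nat, the value at 0 also
   renders the convention (-1)!! = 1. *)
fun double_fact :: "nat \<Rightarrow> nat" where
  "double_fact 0 = 1"
| "double_fact (Suc 0) = 1"
| "double_fact (Suc (Suc n)) = Suc (Suc n) * double_fact n"

definition gauss_moment :: "real \<Rightarrow> nat \<Rightarrow> real" where
  "gauss_moment \<sigma> k = (\<integral>x. normal_density 0 \<sigma> x * x ^ k \<partial>lborel)"

definition perturbed_gauss :: "nat \<Rightarrow> real \<Rightarrow> real \<Rightarrow> real \<Rightarrow> real \<Rightarrow> real" where
  "perturbed_gauss p \<sigma> \<epsilon> C x =
     C / (sqrt (2 * pi) * \<sigma>) * exp (- (x\<^sup>2 / (2 * \<sigma>\<^sup>2))) * exp (- (\<epsilon> * x ^ p))"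

definition differential_entropy :: "(real \<Rightarrow> real) \<Rightarrow> real" where
  "differential_entropy f = - (\<integral>x. f x * ln (f x) \<partial>lborel)"

(* The entropy of the perturbed Gaussian in terms of its normalizing constant c
   and its moments m2, mp of orders 2 and p. *)
definition entropy_expr :: "real \<Rightarrow> real \<Rightarrow> real \<Rightarrow> real \<Rightarrow> real \<Rightarrow> real" where
  "entropy_expr \<sigma> \<epsilon> c m2 mp =
     1 / 2 * ln (2 * pi * \<sigma>\<^sup>2 / c\<^sup>2) + m2 / (2 * \<sigma>\<^sup>2) + \<epsilon> * mp"

definition C1 :: "nat \<Rightarrow> real \<Rightarrow> real \<Rightarrow> real" where
  "C1 p \<sigma> \<epsilon> = 1 / (1 - \<epsilon> * gauss_moment \<sigma> p)"

definition moment1 :: "nat \<Rightarrow> real \<Rightarrow> real \<Rightarrow> nat \<Rightarrow> real" where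
  "moment1 p \<sigma> \<epsilon> k = C1 p \<sigma> \<epsilon> * (gauss_moment \<sigma> k - \<epsilon> * gauss_moment \<sigma> (p + k))"

(* The polynomial B in epsilon that multiplies C1 after substituting C1 and the
   first-order moments in entropy_expr; see entropy_bracket_unique below. *)
definition entropy_bracket :: "nat \<Rightarrow> real \<Rightarrow> real poly" where
  "entropy_bracket p \<sigma> =
     smult (1 / (2 * \<sigma>\<^sup>2)) [:gauss_moment \<sigma> 2, - gauss_moment \<sigma> (p + 2):]
     + [:0, 1:] * [:gauss_moment \<sigma> p, - gauss_moment \<sigma> (p + p):]"

definition entropy1 :: "nat \<Rightarrow> real \<Rightarrow> real \<Rightarrow> real" where
  "entropy1 p \<sigma> \<epsilon> =
     ln (sqrt (2 * pi) * \<sigma> / C1 p \<sigma> \<epsilon>)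
     + C1 p \<sigma> \<epsilon> * poly (entropy_bracket p \<sigma> - monom (coeff (entropy_bracket p \<sigma>) 2) 2) \<epsilon>"

definition beta :: "nat \<Rightarrow> real \<Rightarrow> real \<Rightarrow> real" where
  "beta p \<sigma> \<epsilon> =
     inverse (1 - \<epsilon> * real (double_fact (p - 1)) * \<sigma> ^ p
              - \<epsilon>\<^sup>2 / 2 * real (double_fact (2 * p - 1)) * \<sigma> ^ (2 * p))"

lemma entropy_expr_first_order:
  assumes "\<sigma> > 0" "\<epsilon> * gauss_moment \<sigma> p < 1"
  shows "entropy_expr \<sigma> \<epsilon> (C1 p \<sigma> \<epsilon>) (moment1 p \<sigma> \<epsilon> 2) (moment1 p \<sigma> \<epsilon> p)
         = ln (sqrt (2 * pi) * \<sigma> / C1 p \<sigma> \<epsilon>) + C1 p \<sigma> \<epsilon> * poly (entropy_bracket p \<sigma>) \<epsilon>"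
proof -
  have c: "C1 p \<sigma> \<epsilon> > 0"
    using assms by (simp add: C1_def)
  have "2 * pi * \<sigma>\<^sup>2 / (C1 p \<sigma> \<epsilon>)\<^sup>2 = (sqrt (2 * pi) * \<sigma> / C1 p \<sigma> \<epsilon>)\<^sup>2"
    by (simp add: power_mult_distrib power_divide)
  moreover have "sqrt (2 * pi) * \<sigma> / C1 p \<sigma> \<epsilon> > 0"
    using assms c by simp
  ultimately have "1 / 2 * ln (2 * pi * \<sigma>\<^sup>2 / (C1 p \<sigma> \<epsilon>)\<^sup>2) = ln (sqrt (2 * pi) * \<sigma> / C1 p \<sigma> \<epsilon>)"
    by (simp add: ln_realpow)
  then show ?thesis
    using assms(1)
    by (simp add: entropy_expr_def moment1_def entropy_bracket_def field_simps)
qed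

lemma entropy_bracket_unique:
  assumes "\<sigma> > 0"
  shows "(\<forall>\<epsilon>>0. \<epsilon> * gauss_moment \<sigma> p < 1 \<longrightarrow>
            entropy_expr \<sigma> \<epsilon> (C1 p \<sigma> \<epsilon>) (moment1 p \<sigma> \<epsilon> 2) (moment1 p \<sigma> \<epsilon> p)
            = ln (sqrt (2 * pi) * \<sigma> / C1 p \<sigma> \<epsilon>) + C1 p \<sigma> \<epsilon> * poly B \<epsilon>)
         \<longleftrightarrow> B = entropy_bracket p \<sigma>" (is "?L \<longleftrightarrow> _")
proof
  assume L: ?L
  define \<mu> where "\<mu> = gauss_moment \<sigma> p"
  define I where "I = {0<..<1 / (\<bar>\<mu>\<bar> + 1)}"
  have "poly (B - entropy_bracket p \<sigma>) \<epsilon> = 0" if "\<epsilon> \<in> I" for \<epsilon>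
  proof -
    from that have e: "\<epsilon> > 0" "\<epsilon> * (\<bar>\<mu>\<bar> + 1) < 1"
      by (auto simp: I_def field_simps)
    have "\<epsilon> * \<mu> \<le> \<epsilon> * (\<bar>\<mu>\<bar> + 1)"
      using e(1) by (intro mult_left_mono) auto
    then have lt: "\<epsilon> * gauss_moment \<sigma> p < 1"
      using e(2) by (simp add: \<mu>_def)
    then have "C1 p \<sigma> \<epsilon> \<noteq> 0"
      by (simp add: C1_def)
    then show ?thesis
      using L e(1) lt entropy_expr_first_order[OF assms lt] by simp
  qed
  moreover have "infinite I"
    unfolding I_def by (rule infinite_Ioo) (simp add: add_nonneg_pos)
  ultimately have "infinite {x. poly (B - entropy_bracket p \<sigma>) x = 0}"
    by (metis (mono_tags, lifting) infinite_super mem_Collect_eq subsetI)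
  then have "B - entropy_bracket p \<sigma> = 0"
    using poly_roots_finite by blast
  then show "B = entropy_bracket p \<sigma>"
    by simp
qed (use entropy_expr_first_order[OF assms] in blast)

end

theory Submission
  imports Defs
begin

text \<open>
  Both \<open>H\<close> and its approximation have the shape \<open>ln (sqrt (2 * pi) * \<sigma>) + ln Z + N / Z\<close>. For the
  exact entropy, \<open>Z\<close> is the Gaussian mean of \<open>exp (- \<epsilon> x\<^sup>p)\<close>, so that \<open>C = 1 / Z\<close>, and \<open>N\<close> is the
  Gaussian mean of \<open>(x\<^sup>2 / (2 \<sigma>\<^sup>2) + \<epsilon> x\<^sup>p) exp (- \<epsilon> x\<^sup>p)\<close>. For the approximation, \<open>Z\<close> and \<open>N\<close> are
  replaced by their parts \<open>Z\<^sub>1\<close> and \<open>N\<^sub>1\<close> of degree at most one in \<open>\<epsilon>\<close>.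

  Since \<open>p\<close> is even, \<open>q = \<epsilon> x\<^sup>p\<close> is nonnegative and \<open>0 \<le> exp (- q) - (1 - q) \<le> q\<^sup>2 / 2\<close> everywhere
  (\<open>exp_minus_bounds\<close>). Integrating this against a nonnegative weight (\<open>damped_integral_bounds\<close>)
  and inserting the Gaussian moments gives, with \<open>v = \<epsilon>\<^sup>2 (2p-1)!! \<sigma>\<^sup>2\<^sup>p\<close>,
  \<open>0 \<le> Z - Z\<^sub>1 \<le> v / 2\<close> and \<open>0 \<le> N - (N\<^sub>1 - v) \<le> w\<close>, where \<open>\<beta>\<^sub>p w\<close> is the sum of the last two terms
  of the claimed bound. The \<open>v\<close> in the second estimate is the quadratic term that is dropped from
  the bracket.

  The logarithms differ by at most the first term of the bound. The difference
  \<open>N\<^sub>1 / Z\<^sub>1 - N / Z\<close> is at least \<open>- \<beta>\<^sub>p w\<close> as soon as \<open>N\<^sub>1 \<ge> 0\<close>. It is at most \<open>\<beta>\<^sub>p (5/4) v\<close> because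
  \<open>N\<^sub>1 \<le> Z\<^sub>1 / 2\<close>, and \<open>(5/4) v \<le> w\<close> because \<open>(2p+1)!! = (2p+1) (2p-1)!!\<close> and \<open>2p + 1 \<ge> 5\<close>.
  This elementary part is \<open>log_plus_quotient_error\<close>. Smallness of \<open>\<epsilon> \<sigma>\<^sup>p\<close> makes \<open>N\<^sub>1\<close>
  nonnegative and \<open>\<beta>\<^sub>p\<close> positive. Both conditions involve \<open>\<epsilon>\<close> and \<open>\<sigma>\<close> only through \<open>\<epsilon> \<sigma>\<^sup>p\<close>, which is
  why the threshold depends on \<open>p\<close> alone.
\<close>

section \<open>Gaussian moments\<close>

lemma double_fact_odd_rec:
  "double_fact (Suc (2 * k)) = Suc (2 * k) * double_fact (2 * k - 1)"
  by (cases k) simp_all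

lemma fact_even_double_fact:
  "(fact (2 * k) :: real) = 2 ^ k * fact k * real (double_fact (2 * k - 1))"
proof (induction k)
  case (Suc k)
  have "(fact (2 * Suc k) :: real) = (2 * real k + 2) * (2 * real k + 1) * fact (2 * k)"
    by (simp add: algebra_simps)
  also have "\<dots> = 2 ^ Suc k * fact (Suc k) * real (double_fact (Suc (2 * k)))"
    unfolding Suc double_fact_odd_rec by (simp add: algebra_simps)
  finally show ?case
    by simp
qed simp

lemma has_bochner_integral_gauss_moment:
  assumes "\<sigma> > 0" "even k"
  shows "has_bochner_integral lborel (\<lambda>x. normal_density 0 \<sigma> x * x ^ k)
           (\<sigma> ^ k * real (double_fact (k - 1)))"
proof -
  obtain j where k: "k = 2 * j"
    using assms(2) by blast
  have "fact (2 * j) / ((2 / \<sigma>\<^sup>2) ^ j * fact j) = \<sigma> ^ k * real (double_fact (k - 1))"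
    unfolding fact_even_double_fact k using assms(1)
    by (simp add: power_divide power_mult[symmetric] field_simps)
  then show ?thesis
    using normal_moment_even[OF assms(1), of 0 j] by (simp add: k)
qed

lemma gauss_moment_even:
  assumes "\<sigma> > 0" "even k"
  shows "gauss_moment \<sigma> k = \<sigma> ^ k * real (double_fact (k - 1))"
  unfolding gauss_moment_def
  using has_bochner_integral_gauss_moment[OF assms] by (rule has_bochner_integral_integral_eq)

section \<open>First-order expansion of a damping factor under the integral\<close>

lemma exp_minus_bounds:
  fixes u :: real
  assumes "u \<ge> 0"
  shows "1 - u \<le> exp (- u)" "exp (- u) \<le> 1 - u + u\<^sup>2 / 2"
proof -
  show "1 - u \<le> exp (- u)"
    using exp_ge_add_one_self[of "- u"] by simp
  have pos: "0 \<le> 1 - u + u\<^sup>2 / 2"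
    using zero_le_power2[of "u - 1"] by (simp add: power2_eq_square algebra_simps)
  have "1 \<le> (1 - u + u\<^sup>2 / 2) * (1 + u + u\<^sup>2 / 2)"
  proof -
    have "(1 - u + u\<^sup>2 / 2) * (1 + u + u\<^sup>2 / 2) = 1 + (u\<^sup>2)\<^sup>2 / 4"
      by (simp add: power2_eq_square field_simps)
    then show ?thesis
      by simp
  qed
  also have "\<dots> \<le> (1 - u + u\<^sup>2 / 2) * exp u"
    using exp_lower_Taylor_quadratic[OF assms] pos by (intro mult_left_mono) auto
  finally show "exp (- u) \<le> 1 - u + u\<^sup>2 / 2"
    by (simp add: exp_minus field_simps)
qed

text \<open>
  The two inequalities for \<open>exp (- q)\<close> are preserved by integration because \<open>g\<close> is nonnegative.
  The normalizing constant and the numerator of the entropy are both of this form, with different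
  weights \<open>g\<close> and the same \<open>q\<close>.
\<close>

lemma damped_integral_bounds:
  fixes g q :: "'a \<Rightarrow> real"
  assumes g: "has_bochner_integral M g I0"
    and gq: "has_bochner_integral M (\<lambda>x. g x * q x) I1"
    and gqq: "has_bochner_integral M (\<lambda>x. g x * (q x)\<^sup>2) I2"
    and [measurable]: "q \<in> borel_measurable M"
    and g0: "\<And>x. g x \<ge> 0" and q0: "\<And>x. q x \<ge> 0"
  shows "integrable M (\<lambda>x. g x * exp (- q x))"
    and "I0 - I1 \<le> (\<integral>x. g x * exp (- q x) \<partial>M)"
    and "(\<integral>x. g x * exp (- q x) \<partial>M) \<le> I0 - I1 + I2 / 2"
proof -
  have [measurable]: "g \<in> borel_measurable M"
    using g by (auto simp: has_bochner_integral_iff)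
  show int: "integrable M (\<lambda>x. g x * exp (- q x))"
  proof (rule Bochner_Integration.integrable_bound)
    show "integrable M g"
      using g by (auto simp: has_bochner_integral_iff)
    show "AE x in M. norm (g x * exp (- q x)) \<le> norm (g x)"
      using g0 q0 by (auto simp: abs_mult intro!: mult_left_le)
  qed measurable
  have lo: "has_bochner_integral M (\<lambda>x. g x - g x * q x) (I0 - I1)"
    by (intro has_bochner_integral_diff g gq)
  have hi: "has_bochner_integral M (\<lambda>x. g x - g x * q x + g x * (q x)\<^sup>2 / 2) (I0 - I1 + I2 / 2)"
    by (intro has_bochner_integral_add lo has_bochner_integral_divide_zero gqq)
  have "g x - g x * q x \<le> g x * exp (- q x)" for x
    using mult_left_mono[OF exp_minus_bounds(1)[OF q0] g0, of x x] by (simp add: algebra_simps)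
  then show "I0 - I1 \<le> (\<integral>x. g x * exp (- q x) \<partial>M)"
    using integral_mono[of M "\<lambda>x. g x - g x * q x" "\<lambda>x. g x * exp (- q x)"] lo int
    by (auto simp: has_bochner_integral_iff)
  have "g x * exp (- q x) \<le> g x - g x * q x + g x * (q x)\<^sup>2 / 2" for x
    using mult_left_mono[OF exp_minus_bounds(2)[OF q0] g0, of x x] by (simp add: algebra_simps)
  then show "(\<integral>x. g x * exp (- q x) \<partial>M) \<le> I0 - I1 + I2 / 2"
    using integral_mono[of M "\<lambda>x. g x * exp (- q x)" "\<lambda>x. g x - g x * q x + g x * (q x)\<^sup>2 / 2"]
      hi int
    by (auto simp: has_bochner_integral_iff)
qed

section \<open>Entropy of the perturbed Gaussian\<close>

text \<open>
  The mean of \<open>- ln f\<close> splits because \<open>ln f\<close> is a constant minus \<open>x\<^sup>2 / (2 \<sigma>\<^sup>2) + \<epsilon> x\<^sup>p\<close>.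
\<close>

lemma differential_entropy_perturbed_gauss:
  assumes "\<sigma> > 0" "C > 0"
    and Z: "has_bochner_integral lborel (\<lambda>x. normal_density 0 \<sigma> x * exp (- (\<epsilon> * x ^ p))) Z"
    and N: "has_bochner_integral lborel
              (\<lambda>x. normal_density 0 \<sigma> x * (x\<^sup>2 / (2 * \<sigma>\<^sup>2) + \<epsilon> * x ^ p) * exp (- (\<epsilon> * x ^ p))) N"
    and norm: "(\<integral>x. perturbed_gauss p \<sigma> \<epsilon> C x \<partial>lborel) = 1"
  shows "Z > 0"
    and "differential_entropy (perturbed_gauss p \<sigma> \<epsilon> C) = ln (sqrt (2 * pi) * \<sigma>) + ln Z + N / Z"
proof -
  let ?f = "perturbed_gauss p \<sigma> \<epsilon> C"
  define s where "s = sqrt (2 * pi) * \<sigma>"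
  have s: "s > 0" "sqrt (2 * pi * \<sigma>\<^sup>2) = s"
    using assms(1) by (simp_all add: s_def real_sqrt_mult)
  have f: "?f x = C * (normal_density 0 \<sigma> x * exp (- (\<epsilon> * x ^ p)))" for x
    by (simp add: perturbed_gauss_def normal_density_def s(2)) (simp add: s_def)
  have "C * Z = 1"
    using norm has_bochner_integral_integral_eq[OF Z] by (simp add: f)
  then show "Z > 0"
    using assms(2) by (metis zero_less_mult_pos zero_less_one)
  have C: "C = 1 / Z"
    using \<open>C * Z = 1\<close> \<open>Z > 0\<close> by (simp add: field_simps)
  have "?f x * ln (?f x) =
      C * ln (C / s) * (normal_density 0 \<sigma> x * exp (- (\<epsilon> * x ^ p)))
      - C * (normal_density 0 \<sigma> x * (x\<^sup>2 / (2 * \<sigma>\<^sup>2) + \<epsilon> * x ^ p) * exp (- (\<epsilon> * x ^ p)))" for x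
  proof -
    have ln_f: "ln (?f x) = ln (C / s) - (x\<^sup>2 / (2 * \<sigma>\<^sup>2) + \<epsilon> * x ^ p)"
      unfolding perturbed_gauss_def s_def[symmetric] using assms(2) s(1)
      by (simp add: ln_div ln_mult)
    show ?thesis
      unfolding ln_f unfolding f by (simp only: right_diff_distrib mult_ac)
  qed
  then have "(\<integral>x. ?f x * ln (?f x) \<partial>lborel) = C * ln (C / s) * Z - C * N"
    using has_bochner_integral_diff[OF has_bochner_integral_mult_right[OF Z, of "C * ln (C / s)"]
        has_bochner_integral_mult_right[OF N, of C]]
    by (simp add: has_bochner_integral_iff)
  then show "differential_entropy ?f = ln (sqrt (2 * pi) * \<sigma>) + ln Z + N / Z"
    unfolding differential_entropy_def s_def[symmetric] C using \<open>Z > 0\<close> s(1)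
    by (simp add: ln_div ln_mult)
qed

section \<open>Error of the first-order approximation\<close>

text \<open>
  Here \<open>r = Z - Z1\<close> and \<open>S = N - (N1 - v)\<close> are the remainders of the two expansions, so that
  \<open>N1 / Z1 - N / Z = (N1 * r / Z1 + v - S) / Z\<close>. With \<open>N1 \<le> Z1 / 2\<close>, the positive terms
  \<open>N1 * r / Z1\<close> and \<open>v\<close> add up to at most \<open>v / 4 + v\<close>; this is the origin of the hypothesis on \<open>w\<close>,
  which lets one and the same \<open>w\<close> control both signs of the difference.
\<close>

lemma log_plus_quotient_error:
  fixes Z Z1 N N1 v w :: real
  assumes Z: "Z1 \<le> Z" "Z \<le> Z1 + v / 2" and N: "N1 - v \<le> N" "N \<le> N1 - v + w"
    and N1: "0 \<le> N1" "N1 \<le> Z1 / 2" and v: "0 \<le> v" "v / 2 < Z1" and w: "5 / 4 * v \<le> w"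
    and b: "b = inverse (Z1 - v / 2)"
  shows "\<bar>(ln Z1 + N1 / Z1) - (ln Z + N / Z)\<bar> \<le> ln (1 + b * (v / 2)) + b * w"
proof -
  define r where "r = Z - Z1"
  define S where "S = N - (N1 - v)"
  have pos: "Z1 > 0" "Z > 0"
    using Z v by auto
  have b1: "b > 0" "1 / Z1 \<le> b" "1 / Z \<le> b"
    using v Z pos by (auto simp: b inverse_eq_divide intro!: divide_left_mono)
  have ln1: "ln Z - ln Z1 \<le> ln (1 + b * (v / 2))"
  proof -
    have "Z / Z1 \<le> 1 + 1 / Z1 * (v / 2)"
      using Z(2) pos by (simp add: field_simps)
    also have "\<dots> \<le> 1 + b * (v / 2)"
      using b1(2) v(1) by (intro add_left_mono mult_right_mono) auto
    finally have "ln (Z / Z1) \<le> ln (1 + b * (v / 2))"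
      using pos by (intro ln_mono) auto
    then show ?thesis
      using pos by (simp add: ln_div)
  qed
  have ln0: "ln Z1 \<le> ln Z"
    using Z(1) pos by simp
  have D: "N1 / Z1 - N / Z = (N1 / Z1 * r + v - S) * (1 / Z)"
    using pos by (simp add: r_def S_def field_simps)
  have NZ: "0 \<le> N1 / Z1" "N1 / Z1 \<le> 1 / 2"
    using N1 pos by (auto simp: field_simps)
  have r: "0 \<le> r" "r \<le> v / 2" and S: "0 \<le> S" "S \<le> w"
    using Z N by (auto simp: r_def S_def)
  have prod: "0 \<le> N1 / Z1 * r" "N1 / Z1 * r \<le> 1 / 2 * (v / 2)"
    using mult_nonneg_nonneg[OF NZ(1) r(1)] mult_mono[OF NZ(2) r(2) _ r(1)] by auto
  have bound: "y * (1 / Z) \<le> b * w" if "y \<le> w" for y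
  proof -
    have "y * (1 / Z) \<le> w * (1 / Z)"
      using that pos by (intro mult_right_mono) auto
    also have "\<dots> \<le> w * b"
      using b1(3) w v by (intro mult_left_mono) auto
    finally show ?thesis
      by (simp add: mult.commute)
  qed
  have "N1 / Z1 - N / Z \<le> b * w"
    unfolding D by (rule bound) (use prod S w in linarith)
  moreover have "- (N1 / Z1 - N / Z) \<le> b * w"
  proof -
    have "- (N1 / Z1 - N / Z) = (- (N1 / Z1 * r + v - S)) * (1 / Z)"
      unfolding D by (simp only: mult_minus_left)
    also have "\<dots> \<le> b * w"
      by (rule bound) (use prod S v in linarith)
    finally show ?thesis .
  qed
  ultimately show ?thesis
    using ln0 ln1 by linarith
qed

lemma entropy1_eq:
  assumes "\<sigma> > 0" "even p"
  shows "entropy1 p \<sigma> \<epsilon> =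
    ln (sqrt (2 * pi) * \<sigma> * (1 - \<epsilon> * \<sigma> ^ p * real (double_fact (p - 1))))
    + 1 / (1 - \<epsilon> * \<sigma> ^ p * real (double_fact (p - 1)))
      * (1 / 2 + \<epsilon> * \<sigma> ^ p * (real (double_fact (p - 1)) - 1 / 2 * real (double_fact (p + 1))))"
proof -
  have "coeff (entropy_bracket p \<sigma>) 2 = - gauss_moment \<sigma> (p + p)"
    by (simp add: entropy_bracket_def numeral_2_eq_2)
  then have "poly (entropy_bracket p \<sigma> - monom (coeff (entropy_bracket p \<sigma>) 2) 2) \<epsilon>
      = gauss_moment \<sigma> 2 / (2 * \<sigma>\<^sup>2)
        + \<epsilon> * (gauss_moment \<sigma> p - gauss_moment \<sigma> (p + 2) / (2 * \<sigma>\<^sup>2))"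
    by (simp add: entropy_bracket_def poly_monom power2_eq_square algebra_simps add_divide_distrib)
  also have "\<dots> = 1 / 2 + \<epsilon> * \<sigma> ^ p * (real (double_fact (p - 1)) - 1 / 2 * real (double_fact (p + 1)))"
    using assms
    by (simp add: gauss_moment_even power_add power2_eq_square field_simps)
  finally show ?thesis
    using assms
    by (simp add: entropy1_def C1_def gauss_moment_even mult.assoc)
qed

text \<open>
  In the variable \<open>t = \<epsilon> \<sigma>\<^sup>p\<close> the linear parts are \<open>Z\<^sub>1 = 1 - t a\<close> and \<open>N\<^sub>1 = (1 - t (p-1) a) / 2\<close> with
  \<open>a = (p-1)!!\<close>. Comparing them, \<open>N\<^sub>1 \<le> Z\<^sub>1 / 2\<close> amounts to \<open>p \<ge> 2\<close>, and \<open>N\<^sub>1 \<ge> 0\<close> follows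
  from \<open>t p a < 1\<close>. The summand \<open>1\<close> in the smallness hypothesis gives \<open>t < 1\<close>, so that \<open>t\<^sup>2 \<le> t\<close> and
  the quadratic term in the reciprocal of \<open>\<beta>\<^sub>p\<close> can be absorbed by a linear one.
\<close>

lemma entropy1_error_bound:
  assumes p: "even p" "p > 0" and "\<sigma> > 0" "\<epsilon> > 0" "C > 0"
    and norm: "(\<integral>x. perturbed_gauss p \<sigma> \<epsilon> C x \<partial>lborel) = 1"
    and small: "\<epsilon> * \<sigma> ^ p *
      (real p * real (double_fact (p - 1)) + real (double_fact (2 * p - 1)) + 1) < 1"
  shows "\<bar>entropy1 p \<sigma> \<epsilon> - differential_entropy (perturbed_gauss p \<sigma> \<epsilon> C)\<bar> \<le>
        ln (1 + beta p \<sigma> \<epsilon> * (\<epsilon>\<^sup>2 / 2) * real (double_fact (2 * p - 1)) * \<sigma> ^ (2 * p))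
        + beta p \<sigma> \<epsilon> * (\<epsilon>\<^sup>2 / 4) * real (double_fact (2 * p + 1)) * \<sigma> ^ (2 * p)
        + beta p \<sigma> \<epsilon> * (\<epsilon> ^ 3 / 2) * real (double_fact (3 * p - 1)) * \<sigma> ^ (3 * p)"
proof -
  define t where "t = \<epsilon> * \<sigma> ^ p"
  define a where "a = real (double_fact (p - 1))"
  define b where "b = real (double_fact (2 * p - 1))"
  define c where "c = real (double_fact (3 * p - 1))"
  define v where "v = t\<^sup>2 * b"
  define w where "w = t\<^sup>2 * ((2 * real p + 1) * b) / 4 + t ^ 3 * c / 2"
  define Z1 where "Z1 = 1 - t * a"
  define N1 where "N1 = 1 / 2 + t * (a - 1 / 2 * ((real p + 1) * a))"
  define g where "g x = normal_density 0 \<sigma> x" for x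
  define h where "h x = g x * (x\<^sup>2 / (2 * \<sigma>\<^sup>2) + \<epsilon> * x ^ p)" for x
  define q where "q x = \<epsilon> * x ^ p" for x
  have p2: "p \<ge> 2"
    using p by (cases p) (auto elim: oddE)
  have dp: "real (double_fact (p + 1)) = (real p + 1) * a"
    using double_fact_odd_rec[of "p div 2"] p by (simp add: a_def algebra_simps)
  have d2p: "real (double_fact (2 * p + 1)) = (2 * real p + 1) * b"
    using double_fact_odd_rec[of p] by (simp add: b_def algebra_simps)
  have t: "t > 0"
    using assms by (simp add: t_def)
  have nonneg: "a \<ge> 0" "b \<ge> 0" "c \<ge> 0"
    by (simp_all add: a_def b_def c_def)
  have t2: "t\<^sup>2 = \<epsilon>\<^sup>2 * \<sigma> ^ (2 * p)" and t3: "t ^ 3 = \<epsilon> ^ 3 * \<sigma> ^ (3 * p)"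
    by (simp_all add: t_def power_mult_distrib power_mult[symmetric] mult.commute)
  have moment: "has_bochner_integral lborel (\<lambda>x. g x * x ^ k) (\<sigma> ^ k * real (double_fact (k - 1)))"
    if "even k" for k
    using has_bochner_integral_gauss_moment[OF \<open>\<sigma> > 0\<close> that] by (simp add: g_def)
  have q_nonneg: "q x \<ge> 0" and g_nonneg: "g x \<ge> 0" and h_nonneg: "h x \<ge> 0" for x
    using assms(4) p
    by (auto simp: q_def h_def g_def zero_le_even_power intro!: mult_nonneg_nonneg add_nonneg_nonneg)
  have [measurable]: "q \<in> borel_measurable lborel"
    unfolding q_def by measurable

  have g0: "has_bochner_integral lborel g 1"
    using moment[of 0] by simp
  have g1: "has_bochner_integral lborel (\<lambda>x. g x * q x) (t * a)"
    using has_bochner_integral_mult_right[OF moment[of p], of \<epsilon>] p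
    by (simp add: q_def t_def a_def mult_ac)
  have g2: "has_bochner_integral lborel (\<lambda>x. g x * (q x)\<^sup>2) v"
    using has_bochner_integral_mult_right[OF moment[of "2 * p"], of "\<epsilon>\<^sup>2"]
    by (simp add: q_def t2 b_def v_def power_mult_distrib power_mult[symmetric] mult_ac)
  have s2: "x\<^sup>2 / (2 * \<sigma>\<^sup>2) = 1 / (2 * \<sigma>\<^sup>2) * x\<^sup>2" for x
    by simp
  have quad: "has_bochner_integral lborel (\<lambda>x. g x * (x\<^sup>2 / (2 * \<sigma>\<^sup>2)) * x ^ k)
      (\<sigma> ^ k * real (double_fact (k + 1)) / 2)" if "even k" for k
    using has_bochner_integral_mult_right[OF moment[of "k + 2"], of "1 / (2 * \<sigma>\<^sup>2)"] that \<open>\<sigma> > 0\<close>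
    by (simp add: power_add power2_eq_square mult_ac)
  have h0: "has_bochner_integral lborel h (1 / 2 + t * a)"
    using has_bochner_integral_add[OF quad[of 0] g1]
    by (simp add: h_def[abs_def] q_def distrib_left)
  have quad_p: "has_bochner_integral lborel (\<lambda>x. g x * (x\<^sup>2 / (2 * \<sigma>\<^sup>2)) * x ^ p)
      (\<sigma> ^ p * ((real p + 1) * a) / 2)"
    using quad[OF p(1)] by (simp only: dp)
  have h1: "has_bochner_integral lborel (\<lambda>x. h x * q x) (t * ((real p + 1) * a) / 2 + v)"
  proof -
    have hq: "h x * q x = \<epsilon> * (g x * (x\<^sup>2 / (2 * \<sigma>\<^sup>2)) * x ^ p) + g x * (q x)\<^sup>2" for x
      unfolding h_def q_def power2_eq_square[of "\<epsilon> * _"]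
      by (simp only: distrib_left distrib_right mult_ac)
    have val: "t * ((real p + 1) * a) / 2 + v = \<epsilon> * (\<sigma> ^ p * ((real p + 1) * a) / 2) + v"
      by (simp add: t_def mult.assoc)
    show ?thesis
      unfolding hq val
      by (rule has_bochner_integral_add[OF has_bochner_integral_mult_right[OF quad_p] g2])
  qed
  have h2: "has_bochner_integral lborel (\<lambda>x. h x * (q x)\<^sup>2) (2 * w)"
  proof -
    have expand: "G * (u + \<epsilon> * y) * (\<epsilon> * y)\<^sup>2 = \<epsilon>\<^sup>2 * (G * u * (y * y)) + \<epsilon> ^ 3 * (G * (y * y * y))"
      for G u y :: real
      by (simp add: power2_eq_square power3_eq_cube algebra_simps)
    have pow: "x ^ (2 * p) = x ^ p * x ^ p" "x ^ (3 * p) = x ^ p * x ^ p * x ^ p" for x :: real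
      by (simp_all add: mult.commute[of _ p] power_mult power2_eq_square power3_eq_cube)
    have hqq: "h x * (q x)\<^sup>2 =
        \<epsilon>\<^sup>2 * (g x * (x\<^sup>2 / (2 * \<sigma>\<^sup>2)) * x ^ (2 * p)) + \<epsilon> ^ 3 * (g x * x ^ (3 * p))" for x
      unfolding h_def q_def expand pow ..
    have val: "2 * w = \<epsilon>\<^sup>2 * (\<sigma> ^ (2 * p) * real (double_fact (2 * p + 1)) / 2)
        + \<epsilon> ^ 3 * (\<sigma> ^ (3 * p) * real (double_fact (3 * p - 1)))"
      unfolding w_def t2 t3 d2p c_def by simp
    show ?thesis
      unfolding hqq val
      by (intro has_bochner_integral_add has_bochner_integral_mult_right quad moment) (use p in auto)
  qed

  define Z where "Z = (\<integral>x. g x * exp (- q x) \<partial>lborel)"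
  define N where "N = (\<integral>x. h x * exp (- q x) \<partial>lborel)"
  note gD = damped_integral_bounds[OF g0 g1 g2 _ g_nonneg q_nonneg]
  note hD = damped_integral_bounds[OF h0 h1 h2 _ h_nonneg q_nonneg]
  have Zint: "has_bochner_integral lborel (\<lambda>x. g x * exp (- q x)) Z"
    and Nint: "has_bochner_integral lborel (\<lambda>x. h x * exp (- q x)) N"
    using gD(1) hD(1) by (simp_all add: Z_def N_def has_bochner_integral_iff)
  have Zb: "Z1 \<le> Z" "Z \<le> Z1 + v / 2"
    using gD(2,3) by (simp_all add: Z_def Z1_def)
  have N1_split: "N1 = 1 / 2 + t * a - t * ((real p + 1) * a) / 2"
    by (simp add: N1_def right_diff_distrib)
  have Nb: "N1 - v \<le> N" "N \<le> N1 - v + w"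
    using hD(2,3) by (simp_all add: N_def N1_split)
  note H = differential_entropy_perturbed_gauss[OF \<open>\<sigma> > 0\<close> \<open>C > 0\<close>
      Zint[unfolded g_def q_def] Nint[unfolded g_def h_def q_def] norm]

  have sm: "t * (real p * a) + t * b + t < 1"
    using small by (simp add: t_def a_def b_def algebra_simps)
  have terms: "0 \<le> t * (real p * a)" "0 \<le> t * b" "0 \<le> t * a"
    using t nonneg by auto
  have "t \<le> 1"
    using sm terms by linarith
  then have "v \<le> t * b"
    using t nonneg by (auto simp: v_def power2_eq_square mult_ac intro!: mult_left_le mult_left_mono)
  have ta: "2 * (t * a) \<le> t * (real p * a)"
    using mult_right_mono[of 2 "real p" "t * a"] p2 terms by (simp add: mult_ac)
  have v0: "0 \<le> v"
    using nonneg by (simp add: v_def)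
  have vZ: "v / 2 < Z1"
    using sm terms t ta \<open>v \<le> t * b\<close> unfolding Z1_def by linarith
  have N1_eq: "N1 = 1 / 2 - (t * (real p * a)) / 2 + (t * a) / 2"
    by (simp add: N1_def algebra_simps add_divide_distrib)
  have N1b: "0 \<le> N1" "N1 \<le> Z1 / 2"
  proof -
    show "0 \<le> N1"
      using sm terms t unfolding N1_eq by linarith
    have linear: "1 / 2 - X / 2 + Y / 2 \<le> (1 - Y) / 2" if "2 * Y \<le> X" for X Y :: real
      using that by simp
    show "N1 \<le> Z1 / 2"
      unfolding N1_eq Z1_def by (rule linear[OF ta])
  qed
  have wv: "5 / 4 * v \<le> w"
  proof -
    have "5 * v \<le> (2 * real p + 1) * v"
      using p2 v0 by (intro mult_right_mono) auto
    moreover have "0 \<le> t ^ 3 * c"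
      using t nonneg by simp
    moreover have "w = ((2 * real p + 1) * v) / 4 + (t ^ 3 * c) / 2"
      by (simp add: w_def v_def mult_ac)
    ultimately show ?thesis
      by linarith
  qed
  have beta: "beta p \<sigma> \<epsilon> = inverse (Z1 - v / 2)"
    by (simp add: beta_def Z1_def v_def t_def[symmetric] t2 a_def b_def) (simp add: t_def mult_ac)
  have Z1pos: "Z1 > 0"
    using vZ v0 by linarith
  have "entropy1 p \<sigma> \<epsilon> = ln (sqrt (2 * pi) * \<sigma>) + (ln Z1 + N1 / Z1)"
    using \<open>\<sigma> > 0\<close> Z1pos unfolding entropy1_eq[OF \<open>\<sigma> > 0\<close> p(1)] dp
    by (simp add: ln_mult Z1_def N1_def t_def a_def)
  then have "\<bar>entropy1 p \<sigma> \<epsilon> - differential_entropy (perturbed_gauss p \<sigma> \<epsilon> C)\<bar>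
      = \<bar>(ln Z1 + N1 / Z1) - (ln Z + N / Z)\<bar>"
    using H(2) by simp
  also have "\<dots> \<le> ln (1 + beta p \<sigma> \<epsilon> * (v / 2)) + beta p \<sigma> \<epsilon> * w"
    by (rule log_plus_quotient_error[OF Zb Nb N1b v0 vZ wv beta])
  also have "\<dots> = ln (1 + beta p \<sigma> \<epsilon> * (\<epsilon>\<^sup>2 / 2) * b * \<sigma> ^ (2 * p))
        + beta p \<sigma> \<epsilon> * (\<epsilon>\<^sup>2 / 4) * real (double_fact (2 * p + 1)) * \<sigma> ^ (2 * p)
        + beta p \<sigma> \<epsilon> * (\<epsilon> ^ 3 / 2) * c * \<sigma> ^ (3 * p)"
    unfolding v_def w_def t2 t3 d2p by (simp add: algebra_simps)
  finally show ?thesis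
    by (simp add: b_def c_def)
qed

theorem theorem3:
  fixes p :: nat
  assumes "even p" and "p > 0"
  shows "\<exists>\<delta>::real. \<delta> > 0 \<and> (\<forall>(\<sigma>::real) (\<epsilon>::real) (C::real).
    \<sigma> > 0 \<longrightarrow> \<epsilon> > 0 \<longrightarrow> C > 0 \<longrightarrow> (\<integral>x. perturbed_gauss p \<sigma> \<epsilon> C x \<partial>lborel) = 1 \<longrightarrow>
    \<epsilon> * \<sigma> ^ p < \<delta> \<longrightarrow>
      entropy1 p \<sigma> \<epsilon> =
        ln (sqrt (2 * pi) * \<sigma> * (1 - \<epsilon> * \<sigma> ^ p * real (double_fact (p - 1))))
        + 1 / (1 - \<epsilon> * \<sigma> ^ p * real (double_fact (p - 1)))
          * (1 / 2 + \<epsilon> * \<sigma> ^ p * (real (double_fact (p - 1)) - 1 / 2 * real (double_fact (p + 1))))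
    \<and> \<bar>entropy1 p \<sigma> \<epsilon> - differential_entropy (perturbed_gauss p \<sigma> \<epsilon> C)\<bar> \<le>
        ln (1 + beta p \<sigma> \<epsilon> * (\<epsilon>\<^sup>2 / 2) * real (double_fact (2 * p - 1)) * \<sigma> ^ (2 * p))
        + beta p \<sigma> \<epsilon> * (\<epsilon>\<^sup>2 / 4) * real (double_fact (2 * p + 1)) * \<sigma> ^ (2 * p)
        + beta p \<sigma> \<epsilon> * (\<epsilon> ^ 3 / 2) * real (double_fact (3 * p - 1)) * \<sigma> ^ (3 * p))"
proof -
  let ?K = "real p * real (double_fact (p - 1)) + real (double_fact (2 * p - 1)) + 1"
  have K: "?K > 0"
    by (intro add_nonneg_pos) auto
  show ?thesis
  proof (intro exI[of _ "1 / ?K"] conjI allI impI)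
    fix \<sigma> \<epsilon> C :: real
    assume *: "\<sigma> > 0" "\<epsilon> > 0" "C > 0" "(\<integral>x. perturbed_gauss p \<sigma> \<epsilon> C x \<partial>lborel) = 1"
    assume "\<epsilon> * \<sigma> ^ p < 1 / ?K"
    then have "\<epsilon> * \<sigma> ^ p * ?K < 1"
      using K by (simp only: pos_less_divide_eq)
    then show "\<bar>entropy1 p \<sigma> \<epsilon> - differential_entropy (perturbed_gauss p \<sigma> \<epsilon> C)\<bar> \<le>
        ln (1 + beta p \<sigma> \<epsilon> * (\<epsilon>\<^sup>2 / 2) * real (double_fact (2 * p - 1)) * \<sigma> ^ (2 * p))
        + beta p \<sigma> \<epsilon> * (\<epsilon>\<^sup>2 / 4) * real (double_fact (2 * p + 1)) * \<sigma> ^ (2 * p)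
        + beta p \<sigma> \<epsilon> * (\<epsilon> ^ 3 / 2) * real (double_fact (3 * p - 1)) * \<sigma> ^ (3 * p)"
      by (rule entropy1_error_bound[OF assms *])
    show "entropy1 p \<sigma> \<epsilon> =
        ln (sqrt (2 * pi) * \<sigma> * (1 - \<epsilon> * \<sigma> ^ p * real (double_fact (p - 1))))
        + 1 / (1 - \<epsilon> * \<sigma> ^ p * real (double_fact (p - 1)))
          * (1 / 2 + \<epsilon> * \<sigma> ^ p * (real (double_fact (p - 1)) - 1 / 2 * real (double_fact (p + 1))))"
      using *(1) assms(1) by (rule entropy1_eq)
  next
    show "1 / ?K > 0"
      using K by (rule divide_pos_pos[OF zero_less_one])
  qed
qed

end
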